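(* Let $a\in(1/15,\infty)$ and let $F_a(x)=\psi(x+1)-\mathcal{L}(x,a)$ for $x\in(0,\infty)$. Then $F_a$ is increasing and concave on $(0,\infty)$ if and only if $a\ge a_1=\frac{40+3\sqrt{205}}{105}\approx 0.79003$.
   Context: $\psi(x)=\Gamma'(x)/\Gamma(x)$ ($x>0$) is the digamma (psi) function. For $x>0$ and $a>1/15$, $$\mathcal{L}(x,a)=\frac{1}{90a^{2}+2}\ln\left(x^{2}+x+\frac{3a+1}{3}\right)+\frac{45a^{2}}{90a^{2}+2}\ln\left(x^{2}+x+\frac{15a-1}{45a}\right).$$ *)

theory Defs
  imports "HOL-Analysis.Analysis"
begin

text \<open>The digamma function \<open>\<psi>\<close> is the library's \<^const>\<open>Polygamma\<close> \<open>0\<close>,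
  abbreviated \<open>Digamma\<close>, which the library defines by a series.\<close>

lemma Digamma_eq_deriv_Gamma_div_Gamma:
  fixes x :: real
  assumes "x > 0"
  shows "Digamma x = deriv Gamma x / Gamma x"
proof -
  have "(Gamma has_field_derivative Gamma x * Digamma x) (at x)"
    using assms by (intro has_field_derivative_Gamma) (auto elim!: nonpos_Ints_cases)
  then have "deriv Gamma x = Gamma x * Digamma x"
    by (rule DERIV_imp_deriv)
  then show ?thesis
    using Gamma_real_pos[OF assms] by simp
qed

definition LL :: "real \<Rightarrow> real \<Rightarrow> real" where
  "LL x a =
     1 / (90 * a\<^sup>2 + 2) * ln (x\<^sup>2 + x + (3 * a + 1) / 3)
     + 45 * a\<^sup>2 / (90 * a\<^sup>2 + 2) * ln (x\<^sup>2 + x + (15 * a - 1) / (45 * a))"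

definition F :: "real \<Rightarrow> real \<Rightarrow> real" where
  "F a x = Digamma (x + 1) - LL x a"

end

theory Submission
  imports Defs "HOL-Real_Asymp.Real_Asymp"
begin

text \<open>
  Write \<open>F\<close> for \<open>F a\<close>. Both terms of \<open>F\<close> behave like \<open>ln x\<close> at infinity, so
  \<open>F (x + n) \<longlonglongrightarrow> 0\<close>, and therefore \<open>F x\<close> is the sum over \<open>k\<close> of \<open>D (x + k)\<close>, where
  \<open>D x = F x - F (x + 1)\<close>. The recurrence \<open>\<psi> (x + 1) = \<psi> x + 1 / x\<close> makes \<open>D\<close> an elementary
  function, and monotonicity and concavity pass from \<open>D\<close> to \<open>F\<close> term by term.

  The parameter is best replaced by \<open>c = a - 1 / (45 * a)\<close>. With \<open>z = x\<^sup>2 + x + 1 / 3\<close> the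
  arguments of the two logarithms are \<open>z + a\<close> and \<open>z - 1 / (45 * a)\<close>, their product \<open>q x\<close> is
  \<open>z\<^sup>2 + c * z - 1 / 45\<close>, and the derivative of \<open>LL\<close> in \<open>x\<close> is
  \<open>(2 * x + 1) * (z + c) / (2 * q x)\<close>. Collecting the three fractions of \<open>D'\<close> over a common
  denominator, nearly everything cancels; with \<open>y = x + 1\<close>,
  \<open>D' x = ((c / 3 + 4 / 45)\<^sup>2 / y\<^sup>2 + 7 / 45 * (c - 16 / 21)) / (q x * q y)\<close>.
  This identity (\<open>unit_difference_has_derivative\<close>) is the heart of the proof. Since \<open>q\<close> is
  positive and increasing, for \<open>c \<ge> 16 / 21\<close> the derivative \<open>D'\<close> is nonnegative and decreasing,
  so that \<open>D\<close>, and with it \<open>F\<close>, is increasing and concave. For \<open>c < 16 / 21\<close> the derivative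
  \<open>D'\<close> is negative for large \<open>x\<close>, which makes \<open>F\<close> decrease there, by the same summation.
  Finally \<open>c \<ge> 16 / 21\<close> is a quadratic inequality in \<open>a\<close>, with positive root
  \<open>(40 + 3 * sqrt 205) / 105\<close>.
\<close>

section \<open>Recovering a function from its unit differences\<close>

lemma sums_of_unit_differences:
  fixes f :: "real \<Rightarrow> real"
  assumes "(\<lambda>n. f (x + real n)) \<longlonglongrightarrow> 0"
  shows "(\<lambda>k. f (x + real k) - f (x + real k + 1)) sums f x"
  using telescope_sums'[OF assms] by (simp add: algebra_simps)

text \<open>
  The two lemmas compare the series for \<open>f\<close> at different points term by term. The half-line
  \<open>{X<..}\<close> is closed under \<open>x \<mapsto> x + 1\<close>, so that the hypotheses reach every term; \<open>X > 0\<close>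
  serves for statements about large arguments.
\<close>

lemma mono_on_if_unit_difference_mono_on:
  fixes f :: "real \<Rightarrow> real"
  assumes lim: "\<And>x. X < x \<Longrightarrow> (\<lambda>n. f (x + real n)) \<longlonglongrightarrow> 0"
    and mono: "mono_on {X<..} (\<lambda>x. f x - f (x + 1))"
  shows "mono_on {X<..} f"
proof (rule mono_onI)
  fix x y assume xy: "x \<in> {X<..}" "y \<in> {X<..}" "x \<le> y"
  have "f (x + real k) - f (x + real k + 1) \<le> f (y + real k) - f (y + real k + 1)" for k
    using mono_onD[OF mono, of "x + real k" "y + real k"] xy by simp
  then show "f x \<le> f y"
    using xy by (intro sums_le[OF _ sums_of_unit_differences[of f x] sums_of_unit_differences[of f y]])
      (simp_all add: lim)
qed

lemma concave_on_if_unit_difference_concave_on: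
  fixes f :: "real \<Rightarrow> real"
  assumes lim: "\<And>x. X < x \<Longrightarrow> (\<lambda>n. f (x + real n)) \<longlonglongrightarrow> 0"
    and conc: "concave_on {X<..} (\<lambda>x. f x - f (x + 1))"
  shows "concave_on {X<..} f"
  unfolding concave_on_iff
proof (intro conjI ballI allI impI)
  let ?d = "\<lambda>x. f x - f (x + 1)"
  fix x y u v :: real
  assume xy: "x \<in> {X<..}" "y \<in> {X<..}" and uv: "0 \<le> u" "0 \<le> v" "u + v = 1"
  have sums: "(\<lambda>k. ?d (w + real k)) sums f w" if "w \<in> {X<..}" for w
    using that by (auto intro: sums_of_unit_differences lim)
  have mid: "u *\<^sub>R x + v *\<^sub>R y \<in> {X<..}"
    using convexD[OF convex_real_interval(3) xy uv] .
  have shift: "u *\<^sub>R x + v *\<^sub>R y + real k = u *\<^sub>R (x + real k) + v *\<^sub>R (y + real k)" for k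
    using uv(3) by (simp add: algebra_simps flip: distrib_right)
  have "u * ?d (x + real k) + v * ?d (y + real k) \<le> ?d (u *\<^sub>R x + v *\<^sub>R y + real k)" for k
    unfolding shift using conc[unfolded concave_on_iff] xy uv by (auto simp del: real_scaleR_def)
  then show "u * f x + v * f y \<le> f (u *\<^sub>R x + v *\<^sub>R y)"
    using sums_add[OF sums_mult[OF sums[OF xy(1)]] sums_mult[OF sums[OF xy(2)]]] sums[OF mid]
    by (rule sums_le)
qed (rule convex_real_interval)

section \<open>Decay along unit steps\<close>

lemma Digamma_shift_minus_ln_tendsto_0:
  fixes z :: real
  assumes "z > 0"
  shows "(\<lambda>n. Digamma (z + real n) - ln (real n)) \<longlonglongrightarrow> 0"
proof -
  have "Digamma (z + real n) = Digamma z + (\<Sum>k<n. inverse (z + real k))" for n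
    using assms Polygamma_plus_of_nat[of n z 0] by (force simp: field_simps)
  moreover have "(\<lambda>n. Digamma z - (ln (real n) - (\<Sum>k<n. inverse (z + real k)))) \<longlonglongrightarrow> Digamma z - Digamma z"
    using assms Digamma_LIMSEQ[of z] by (intro tendsto_intros) auto
  ultimately show ?thesis
    by (simp add: algebra_simps)
qed

text \<open>
  The weights of the two logarithms add up to \<open>1 / 2\<close>, and each argument is asymptotic to
  \<open>n\<^sup>2\<close>, so \<open>LL\<close> cancels exactly the \<open>ln n\<close> growth of the digamma function.
\<close>

lemma F_shift_tendsto_0:
  assumes "x > 0"
  shows "(\<lambda>n. F a (x + real n)) \<longlonglongrightarrow> 0"
proof -
  define p q where "p = 1 / (90 * a\<^sup>2 + 2)" and "q = 45 * a\<^sup>2 / (90 * a\<^sup>2 + 2)"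
  have "90 * a\<^sup>2 + 2 > 0"
    by (simp add: add_nonneg_pos)
  then have pq: "2 * p + 2 * q = 1"
    by (simp add: p_def q_def add.commute flip: add_divide_distrib)
  have log: "(\<lambda>n. ln ((x + real n)\<^sup>2 + (x + real n) + s) - 2 * ln (real n)) \<longlonglongrightarrow> 0" for s
    by real_asymp
  let ?l = "\<lambda>s n. ln ((x + real n)\<^sup>2 + (x + real n) + s)"
  have F_eq: "F a (x + real n) = (Digamma (x + 1 + real n) - ln (real n))
      - p * (?l ((3 * a + 1) / 3) n - 2 * ln (real n))
      - q * (?l ((15 * a - 1) / (45 * a)) n - 2 * ln (real n))" for n
  proof -
    have "ln (real n) = (2 * p + 2 * q) * ln (real n)" by (simp add: pq)
    then show ?thesis
      unfolding F_def LL_def p_def[symmetric] q_def[symmetric] by (simp add: algebra_simps)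
  qed
  have "(\<lambda>n. F a (x + real n)) \<longlonglongrightarrow> 0 - p * 0 - q * 0"
    unfolding F_eq using assms
    by (intro tendsto_diff tendsto_mult tendsto_const log Digamma_shift_minus_ln_tendsto_0) auto
  then show ?thesis by simp
qed

section \<open>The derivative of the unit difference\<close>

text \<open>
  The arguments of the two logarithms are \<open>z + a\<close> and \<open>z - b\<close> with \<open>z = x\<^sup>2 + x + 1 / 3\<close> and
  \<open>a * b = 1 / 45\<close>; this is \<open>a - b\<close>, the only combination of \<open>a\<close> and \<open>b\<close> that enters the
  derivative of \<open>LL\<close>.
\<close>

definition skew :: "real \<Rightarrow> real" where
  "skew a = a - 1 / (45 * a)"

definition arg_prod :: "real \<Rightarrow> real \<Rightarrow> real" where
  "arg_prod a x = (x\<^sup>2 + x + (3 * a + 1) / 3) * (x\<^sup>2 + x + (15 * a - 1) / (45 * a))"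

lemma log_arguments_pos:
  fixes a x :: real
  assumes "a > 1 / 15" "x > 0"
  shows "x\<^sup>2 + x + (3 * a + 1) / 3 > 0" "x\<^sup>2 + x + (15 * a - 1) / (45 * a) > 0"
proof -
  have "x\<^sup>2 > 0" "(3 * a + 1) / 3 > 0" "(15 * a - 1) / (45 * a) > 0"
    using assms by simp_all
  then show "x\<^sup>2 + x + (3 * a + 1) / 3 > 0" "x\<^sup>2 + x + (15 * a - 1) / (45 * a) > 0"
    using assms(2) by linarith+
qed

lemma arg_prod_pos: "a > 1 / 15 \<Longrightarrow> x > 0 \<Longrightarrow> arg_prod a x > 0"
  unfolding arg_prod_def by (intro mult_pos_pos log_arguments_pos)

lemma arg_prod_mono:
  assumes "a > 1 / 15" "0 < x" "x \<le> y"
  shows "arg_prod a x \<le> arg_prod a y"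
proof -
  have "x\<^sup>2 + x \<le> y\<^sup>2 + y"
    using assms by (intro add_mono power_mono) auto
  then show ?thesis
    unfolding arg_prod_def using assms
    by (intro mult_mono) (auto intro: less_imp_le log_arguments_pos)
qed

lemma arg_prod_expand:
  fixes a x :: real
  assumes "a > 0"
  defines "z \<equiv> x\<^sup>2 + x + 1 / 3"
  shows "arg_prod a x = z\<^sup>2 + skew a * z - 1 / 45"
  using assms(1) unfolding arg_prod_def skew_def z_def
  by (simp add: field_simps power2_eq_square)

text \<open>
  The weights are \<open>b / (2 * (a + b))\<close> for \<open>ln (z + a)\<close> and \<open>a / (2 * (a + b))\<close> for
  \<open>ln (z - b)\<close>. Over the common denominator the numerator becomes
  \<open>b * (z - b) + a * (z + a) = (a + b) * (z + a - b)\<close>, and the factor \<open>a + b\<close> cancels.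
\<close>

lemma LL_has_derivative:
  assumes "a > 1 / 15" "x > 0"
  shows "((\<lambda>x. LL x a) has_real_derivative
           (2 * x + 1) * (x\<^sup>2 + x + 1 / 3 + skew a) / (2 * arg_prod a x)) (at x)"
proof -
  define A B where "A = x\<^sup>2 + x + (3 * a + 1) / 3" and "B = x\<^sup>2 + x + (15 * a - 1) / (45 * a)"
  have pos: "A > 0" "B > 0"
    using log_arguments_pos[OF assms] by (auto simp: A_def B_def)
  define p q where "p = 1 / (90 * a\<^sup>2 + 2)" and "q = 45 * a\<^sup>2 / (90 * a\<^sup>2 + 2)"
  have "90 * a\<^sup>2 + 2 > 0"
    by (simp add: add_nonneg_pos)
  then have "2 * (p * B + q * A) = x\<^sup>2 + x + 1 / 3 + skew a"
    using assms(1) unfolding p_def q_def A_def B_def skew_def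
    by (simp add: divide_simps) (simp add: algebra_simps power2_eq_square)
  moreover have "p * ((2 * x + 1) / A) + q * ((2 * x + 1) / B) =
      (2 * x + 1) * (2 * (p * B + q * A)) / (2 * (A * B))"
    using pos by (simp add: divide_simps) (simp add: algebra_simps)
  ultimately have eq: "p * ((2 * x + 1) / A) + q * ((2 * x + 1) / B) =
      (2 * x + 1) * (x\<^sup>2 + x + 1 / 3 + skew a) / (2 * arg_prod a x)"
    by (simp only: arg_prod_def flip: A_def B_def)
  have ln: "((\<lambda>x. ln (x\<^sup>2 + x + s)) has_real_derivative (2 * x + 1) / (x\<^sup>2 + x + s)) (at x)"
    if "x\<^sup>2 + x + s > 0" for s
    using that by (auto intro!: derivative_eq_intros)
  show ?thesis
    using DERIV_add[OF DERIV_cmult[OF ln] DERIV_cmult[OF ln]] pos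
    unfolding LL_def p_def[symmetric] q_def[symmetric] eq[symmetric] A_def B_def by blast
qed

text \<open>
  The numerator is divided by \<open>(x + 1)\<^sup>2\<close> in advance: in this form its monotonicity and its limit
  \<open>7 / 45 * (skew a - 16 / 21)\<close> at infinity are visible.
\<close>

definition diff_slope :: "real \<Rightarrow> real \<Rightarrow> real" where
  "diff_slope a x = ((skew a / 3 + 4 / 45)\<^sup>2 / (x + 1)\<^sup>2 + 7 / 45 * (skew a - 16 / 21))
                 / (arg_prod a x * arg_prod a (x + 1))"

text \<open>
  Put \<open>y = x + 1\<close>. The product of logarithm arguments at \<open>x = y - 1\<close> is the one at \<open>y\<close> with
  \<open>y\<close> replaced by \<open>- y\<close>, so the sum of the three fractions is even in \<open>y\<close>. The terms of \<open>LL\<close>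
  match the digamma asymptotics to high order, and this forces all powers of \<open>y\<close> above the
  second to disappear from the numerator.
\<close>

lemma unit_difference_has_derivative:
  assumes "a > 1 / 15" "x > 0"
  shows "((\<lambda>x. F a x - F a (x + 1)) has_real_derivative diff_slope a x) (at x)"
proof -
  define c where "c = skew a"
  define y where "y = x + 1"
  define u where "u = y\<^sup>2 - y + 1 / 3"
  define v where "v = y\<^sup>2 + y + 1 / 3"
  have u: "x\<^sup>2 + x + 1 / 3 = u" and v: "y\<^sup>2 + y + 1 / 3 = v"
    by (simp_all add: u_def v_def y_def power2_eq_square algebra_simps)
  have Qu: "arg_prod a x = u\<^sup>2 + c * u - 1 / 45" and Qv: "arg_prod a y = v\<^sup>2 + c * v - 1 / 45"
    using assms arg_prod_expand[of a x] arg_prod_expand[of a y] unfolding u v c_def by simp_all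
  have "arg_prod a x > 0" "arg_prod a y > 0" "y > 0"
    using assms by (auto simp: y_def intro!: arg_prod_pos)
  note pos = this
  \<comment> \<open>A polynomial identity in \<open>y\<close> and \<open>c\<close>: in the expansion of the left-hand side the terms of degree 4 to 8 in \<open>y\<close> cancel.\<close>
  have numerator: "arg_prod a x * arg_prod a y + y\<^sup>2 * ((2 * y + 1) * (v + c) / 2 * arg_prod a x - (2 * y - 1) * (u + c) / 2 * arg_prod a y)
      = (c / 3 + 4 / 45)\<^sup>2 + 7 / 45 * (c - 16 / 21) * y\<^sup>2"
    unfolding Qu Qv u_def v_def by (simp add: field_simps power2_eq_square)
  have slope_eq: "diff_slope a x = 1 / y\<^sup>2 + (2 * y + 1) * (v + c) / (2 * arg_prod a y) - (2 * y - 1) * (u + c) / (2 * arg_prod a x)"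
  proof -
    have "diff_slope a x = ((c / 3 + 4 / 45)\<^sup>2 + 7 / 45 * (c - 16 / 21) * y\<^sup>2) / (y\<^sup>2 * arg_prod a x * arg_prod a y)"
      unfolding diff_slope_def c_def[symmetric] y_def[symmetric] using pos
      by (simp add: divide_simps)
    then show ?thesis
      unfolding numerator[symmetric] using pos
      by (simp add: divide_simps) (simp add: algebra_simps)
  qed
  have "((\<lambda>x. LL (x + 1) a - LL x a - 1 / (x + 1)) has_real_derivative diff_slope a x) (at x)"
  proof -
    have "((\<lambda>x. LL x a) has_real_derivative (2 * y + 1) * (v + c) / (2 * arg_prod a y)) (at (x + 1))"
      using LL_has_derivative[of a y] assms unfolding v c_def[symmetric] by (simp add: y_def)
    then have next_LL: "((\<lambda>x. LL (x + 1) a) has_real_derivative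
        (2 * y + 1) * (v + c) / (2 * arg_prod a y)) (at x)"
      by (simp only: DERIV_shift)
    have LL: "((\<lambda>x. LL x a) has_real_derivative (2 * y - 1) * (u + c) / (2 * arg_prod a x)) (at x)"
      using LL_has_derivative[OF assms] unfolding u c_def[symmetric]
      by (simp add: y_def add.commute)
    have recip: "((\<lambda>x. 1 / (x + 1)) has_real_derivative - (1 / y\<^sup>2)) (at x)"
      using assms by (auto intro!: derivative_eq_intros simp: y_def power2_eq_square)
    show ?thesis
      unfolding slope_eq using DERIV_diff[OF DERIV_diff[OF next_LL LL] recip]
      by (simp add: algebra_simps)
  qed
  \<comment> \<open>The digamma recurrence needs a nonzero argument, hence the local equality near \<open>x\<close>.\<close>
  moreover have "\<forall>\<^sub>F t in nhds x. F a t - F a (t + 1) = LL (t + 1) a - LL t a - 1 / (t + 1)"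
  proof (rule eventually_nhds_in_open[of "{0<..}" x, THEN eventually_mono])
    show "F a t - F a (t + 1) = LL (t + 1) a - LL t a - 1 / (t + 1)" if "t \<in> {0<..}" for t
      using that Digamma_plus1[of "t + 1"] by (simp add: F_def)
  qed (use assms(2) in auto)
  ultimately show ?thesis
    by (subst DERIV_cong_ev[OF refl _ refl])
qed

section \<open>The sign of the derivative and the critical parameter\<close>

lemma diff_slope_nonneg:
  assumes "a > 1 / 15" "skew a \<ge> 16 / 21" "0 < x"
  shows "diff_slope a x \<ge> 0"
proof -
  have "arg_prod a x > 0" "arg_prod a (x + 1) > 0"
    using assms by (simp_all add: arg_prod_pos)
  then show ?thesis
    using assms(2) by (simp add: diff_slope_def)
qed

lemma diff_slope_antimono:
  assumes "a > 1 / 15" "skew a \<ge> 16 / 21" "0 < x" "x \<le> y"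
  shows "diff_slope a y \<le> diff_slope a x"
  unfolding diff_slope_def
proof (rule frac_le)
  let ?k = "(skew a / 3 + 4 / 45)\<^sup>2"
  have "(x + 1)\<^sup>2 \<le> (y + 1)\<^sup>2"
    using assms by (intro power_mono) simp_all
  then have "?k / (y + 1)\<^sup>2 \<le> ?k / (x + 1)\<^sup>2"
    using assms by (intro frac_le) simp_all
  then show "?k / (y + 1)\<^sup>2 + 7 / 45 * (skew a - 16 / 21)
      \<le> ?k / (x + 1)\<^sup>2 + 7 / 45 * (skew a - 16 / 21)"
    by simp
  show "0 \<le> ?k / (x + 1)\<^sup>2 + 7 / 45 * (skew a - 16 / 21)"
    using assms(2) by simp
  have "arg_prod a x > 0" "arg_prod a (x + 1) > 0" "arg_prod a y > 0" "arg_prod a x \<le> arg_prod a y" "arg_prod a (x + 1) \<le> arg_prod a (y + 1)"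
    using assms by (simp_all add: arg_prod_pos arg_prod_mono)
  then show "0 < arg_prod a x * arg_prod a (x + 1)" "arg_prod a x * arg_prod a (x + 1) \<le> arg_prod a y * arg_prod a (y + 1)"
    by (simp_all add: mult_mono)
qed

lemma diff_slope_eventually_neg:
  assumes "a > 1 / 15" "skew a < 16 / 21"
  shows "\<exists>X>0. \<forall>x>X. diff_slope a x < 0"
proof -
  define K where "K = (skew a / 3 + 4 / 45)\<^sup>2"
  define m where "m = 7 / 45 * (skew a - 16 / 21)"
  have "m < 0" using assms by (simp add: m_def)
  have "((\<lambda>x. K / (x + 1)\<^sup>2 + m) \<longlongrightarrow> m) at_top"
    by real_asymp
  then have "\<forall>\<^sub>F x in at_top. K / (x + 1)\<^sup>2 + m < 0"
    using \<open>m < 0\<close> by (rule order_tendstoD)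
  then obtain X where X: "\<And>x. x \<ge> X \<Longrightarrow> K / (x + 1)\<^sup>2 + m < 0"
    by (auto simp: eventually_at_top_linorder)
  have "diff_slope a x < 0" if "x > max X 1" for x
    unfolding diff_slope_def K_def[symmetric] m_def[symmetric]
    using that assms X[of x] by (intro divide_neg_pos mult_pos_pos arg_prod_pos) auto
  then show ?thesis
    by (intro exI[of _ "max X 1"]) auto
qed

text \<open>
  After multiplication by \<open>a\<close> the condition reads \<open>a\<^sup>2 - 16 / 21 * a - 1 / 45 \<ge> 0\<close>. The roots
  have product \<open>- 1 / 45\<close>, so exactly one of them is positive.
\<close>

lemma skew_ge_iff:
  assumes "a > 1 / 15"
  shows "skew a \<ge> 16 / 21 \<longleftrightarrow> a \<ge> (40 + 3 * sqrt 205) / 105"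
proof -
  define r where "r = (40 + 3 * sqrt 205) / 105"
  define r' where "r' = (40 - 3 * sqrt 205) / 105"
  have "sqrt 205 > 14" by (rule real_less_rsqrt) simp
  then have "r' < 0" by (simp add: r'_def)
  have "skew a - 16 / 21 = (a - r) * (a - r') / a"
    using assms unfolding skew_def r_def r'_def
    by (simp add: field_simps power2_eq_square[symmetric])
  moreover have "(a - r') / a > 0"
    using assms \<open>r' < 0\<close> by simp
  ultimately have "skew a - 16 / 21 \<ge> 0 \<longleftrightarrow> a - r \<ge> 0"
    by (metis times_divide_eq_right zero_le_mult_iff not_le order_less_imp_le)
  then show ?thesis by (simp add: r_def)
qed

section \<open>The characterisation\<close>

theorem corollary1:
  fixes a :: real
  assumes "a > 1 / 15"
  shows "(mono_on {0<..} (F a) \<and> concave_on {0<..} (F a)) \<longleftrightarrow>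
           a \<ge> (40 + 3 * sqrt 205) / 105"
proof
  assume "a \<ge> (40 + 3 * sqrt 205) / 105"
  then have skew: "skew a \<ge> 16 / 21"
    using skew_ge_iff[OF assms] by simp
  have "mono_on {0<..} (\<lambda>x. F a x - F a (x + 1))"
  proof (rule mono_onI)
    fix x y :: real assume xy: "x \<in> {0<..}" "y \<in> {0<..}" "x \<le> y"
    show "F a x - F a (x + 1) \<le> F a y - F a (y + 1)"
    proof (rule DERIV_nonneg_imp_nondecreasing[OF xy(3)])
      fix t assume "x \<le> t" "t \<le> y"
      then have "t > 0" using xy(1) by simp
      then show "\<exists>d. ((\<lambda>x. F a x - F a (x + 1)) has_real_derivative d) (at t) \<and> 0 \<le> d"
        using unit_difference_has_derivative[OF assms] diff_slope_nonneg[OF assms skew] by blast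
    qed
  qed
  moreover have "concave_on {0<..} (\<lambda>x. F a x - F a (x + 1))"
    unfolding concave_on_def
  proof (rule convex_on_realI)
    show "((\<lambda>x. - (F a x - F a (x + 1))) has_real_derivative - diff_slope a x) (at x)"
      if "x \<in> {0<..}" for x
      using that by (intro DERIV_minus unit_difference_has_derivative assms) simp
  qed (auto intro: diff_slope_antimono assms skew)
  ultimately show "mono_on {0<..} (F a) \<and> concave_on {0<..} (F a)"
    using mono_on_if_unit_difference_mono_on concave_on_if_unit_difference_concave_on
      F_shift_tendsto_0 by blast
next
  assume incr: "mono_on {0<..} (F a) \<and> concave_on {0<..} (F a)"
  show "a \<ge> (40 + 3 * sqrt 205) / 105"
  proof (rule ccontr)
    assume "\<not> ?thesis"
    then have "skew a < 16 / 21"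
      using skew_ge_iff[OF assms] by simp
    then obtain X where X: "X > 0" "\<And>x. x > X \<Longrightarrow> diff_slope a x < 0"
      using diff_slope_eventually_neg[OF assms] by blast
    have less: "F a y - F a (y + 1) < F a x - F a (x + 1)" if "X < x" "x < y" for x y
    proof (rule DERIV_neg_imp_decreasing[OF that(2)])
      fix t assume "x \<le> t" "t \<le> y"
      then have "t > X" using that(1) by simp
      then show "\<exists>d. ((\<lambda>x. F a x - F a (x + 1)) has_real_derivative d) (at t) \<and> d < 0"
        using unit_difference_has_derivative[OF assms, of t] X by force
    qed
    \<comment> \<open>A function that increases and decreases on \<open>{X<..}\<close> is constant there, but its unit difference decreases strictly.\<close>
    have antimono: "mono_on {X<..} (\<lambda>x. - F a x)"
    proof (rule mono_on_if_unit_difference_mono_on)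
      fix x assume "X < x"
      then have "(\<lambda>n. F a (x + real n)) \<longlonglongrightarrow> 0"
        using X(1) by (intro F_shift_tendsto_0) simp
      from tendsto_minus[OF this] show "(\<lambda>n. - F a (x + real n)) \<longlonglongrightarrow> 0"
        by (simp only: minus_zero)
    next
      show "mono_on {X<..} (\<lambda>x. - F a x - - F a (x + 1))"
      proof (rule mono_onI)
        fix x y :: real assume "x \<in> {X<..}" "y \<in> {X<..}" "x \<le> y"
        then have "x = y \<or> F a y - F a (y + 1) < F a x - F a (x + 1)"
          using less[of x y] by (metis greaterThan_iff order_le_less)
        then show "- F a x - - F a (x + 1) \<le> - F a y - - F a (y + 1)"
          by (elim disjE) simp_all
      qed
    qed
    have const: "F a x = F a y" if "X < x" "x \<le> y" for x y
    proof (rule antisym[rotated])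
      show "F a y \<le> F a x"
        using mono_onD[OF antimono, of x y] that by simp
      show "F a x \<le> F a y"
        using mono_onD[OF conjunct1[OF incr], of x y] that X(1) by simp
    qed
    have "F a (X + 1) = F a (X + 1 + 1)" "F a (X + 2) = F a (X + 2 + 1)"
      by (rule const; simp)+
    moreover have "F a (X + 2) - F a (X + 2 + 1) < F a (X + 1) - F a (X + 1 + 1)"
      by (rule less) simp_all
    ultimately show False
      by linarith
  qed
qed

end
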